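(* Let $1\le p<+\infty$, let $\sigma_\ell(x)=(1+e^{-x})^{-1}$ be the logistic function, let $N,M$ be positive integers and let $\widetilde f:[0,N]\times[0,M]\to\mathbb{R}$ be a digital image function, i.e. $\widetilde f=\sum_{i=1}^N\sum_{j=1}^M F_{i,j}\chi_{i,j}$ with $F_{i,j}\in\{0,1,\dots,255\}$. Then there is a constant $C>0$, independent of $n$, such that for every $n\in\mathbb{N}^+$ $$\|F_n^{\sigma_\ell}(\widetilde f,\cdot)-\widetilde f(\cdot)\|_p\ \le\ 255\,(2^{p-1}MN)^{1/p}\,C\left[\left(\frac{\ln n}{n}\right)^{1/p}+\left(\frac1n\right)^{1/p}\right],$$ and the right-hand side is $\mathcal{O}\big((\log(n)/n)^{1/p}\big)$ as $n\to+\infty$.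
   Context: Let $I=[0,N]\times[0,M]$. For $1\le i\le N$, $1\le j\le M$, $\chi_{i,j}$ is the characteristic function of the unit pixel which is the product of $[i-1,i)$ (closed on the right if $i=N$) and $[j-1,j)$ (closed on the right if $j=M$); these pixels partition $I$. Set $\phi_{\sigma_\ell}(x)=\frac12[\sigma_\ell(x+1)-\sigma_\ell(x-1)]$, $\Psi_{\sigma_\ell}(\mathtt{x})=\phi_{\sigma_\ell}(x_1)\phi_{\sigma_\ell}(x_2)$ for $\mathtt{x}=(x_1,x_2)\in\mathbb{R}^2$, and $\mathcal{A}_n=\{\mathtt{k}\in\mathbb{Z}^2:0\le k_1\le nN,\ 0\le k_2\le nM\}$. The neural network operators activated by $\sigma_\ell$ are $$F_n^{\sigma_\ell}(f,\mathtt{x})=\frac{\sum_{\mathtt{k}\in\mathcal{A}_n}f(\mathtt{k}/n)\,\Psi_{\sigma_\ell}(n\mathtt{x}-\mathtt{k})}{\sum_{\mathtt{k}\in\mathcal{A}_n}\Psi_{\sigma_\ell}(n\mathtt{x}-\mathtt{k})},\qquad \mathtt{x}\in I,\ \mathtt{k}/n=(k_1/n,k_2/n).$$ $\|\cdot\|_p$ is the $L^p(I)$-norm with respect to Lebesgue measure. *)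

theory Defs
  imports "HOL-Analysis.Analysis" "HOL-Library.Landau_Symbols"
begin

definition logistic :: "real \<Rightarrow> real" where
  "logistic x = 1 / (1 + exp (- x))"

definition phi :: "(real \<Rightarrow> real) \<Rightarrow> real \<Rightarrow> real" where
  "phi \<sigma> x = (1 / 2) * (\<sigma> (x + 1) - \<sigma> (x - 1))"

definition Psi :: "(real \<Rightarrow> real) \<Rightarrow> real \<times> real \<Rightarrow> real" where
  "Psi \<sigma> x = phi \<sigma> (fst x) * phi \<sigma> (snd x)"

definition node_indices :: "nat \<Rightarrow> nat \<Rightarrow> nat \<Rightarrow> (int \<times> int) set" where
  "node_indices N M n = {0..int (n * N)} \<times> {0..int (n * M)}"

definition nn_op ::
  "(real \<Rightarrow> real) \<Rightarrow> nat \<Rightarrow> nat \<Rightarrow> nat \<Rightarrow> (real \<times> real \<Rightarrow> real) \<Rightarrow> real \<times> real \<Rightarrow> real" where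
  "nn_op \<sigma> N M n f x =
     (\<Sum>(k1, k2) \<in> node_indices N M n.
        f (of_int k1 / real n, of_int k2 / real n) *
        Psi \<sigma> (real n * fst x - of_int k1, real n * snd x - of_int k2)) /
     (\<Sum>(k1, k2) \<in> node_indices N M n.
        Psi \<sigma> (real n * fst x - of_int k1, real n * snd x - of_int k2))"

definition image_domain :: "nat \<Rightarrow> nat \<Rightarrow> (real \<times> real) set" where
  "image_domain N M = {0..real N} \<times> {0..real M}"

definition unit_cell :: "nat \<Rightarrow> nat \<Rightarrow> real set" where
  "unit_cell N i = (if i = N then {real i - 1..real i} else {real i - 1..<real i})"

text \<open>The representation is only required on the domain rectangle: values of the
  total function \<open>f\<close> outside it are arbitrary and are never used by \<^const>\<open>nn_op\<close>.\<close>

definition digital_image :: "nat \<Rightarrow> nat \<Rightarrow> (real \<times> real \<Rightarrow> real) \<Rightarrow> bool" where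
  "digital_image N M f \<longleftrightarrow>
     (\<exists>F :: nat \<Rightarrow> nat \<Rightarrow> nat.
        (\<forall>i\<in>{1..N}. \<forall>j\<in>{1..M}. F i j \<in> {0..255}) \<and>
        (\<forall>x\<in>image_domain N M.
           f x = (\<Sum>i = 1..N. \<Sum>j = 1..M.
                    real (F i j) * indicator (unit_cell N i \<times> unit_cell M j) x)))"

text \<open>The Bochner integral of a non-integrable function is \<open>0\<close>, so \<open>Lp_norm\<close> is
  meaningful only together with \<open>in_Lp\<close>.\<close>

definition in_Lp :: "real \<Rightarrow> 'a measure \<Rightarrow> ('a \<Rightarrow> real) \<Rightarrow> bool" where
  "in_Lp p \<mu> f \<longleftrightarrow> f \<in> borel_measurable \<mu> \<and> integrable \<mu> (\<lambda>x. \<bar>f x\<bar> powr p)"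

definition Lp_norm :: "real \<Rightarrow> 'a measure \<Rightarrow> ('a \<Rightarrow> real) \<Rightarrow> real" where
  "Lp_norm p \<mu> f = (\<integral>x. \<bar>f x\<bar> powr p \<partial>\<mu>) powr (1 / p)"

end

theory Submission imports Defs begin

text \<open>The operator at \<open>x\<close> is a weighted mean of node values of the image \<open>f\<close>, and \<open>f\<close> is constant
  on each pixel. So only the nodes outside the pixel of \<open>x\<close> contribute to the error, each at most
  255. As the weights are products, the total relative weight of these nodes is at most the sum of
  two one-dimensional quantities: for each coordinate \<open>t\<close> of \<open>x\<close>, the weight of the nodes outside
  the unit cell of \<open>t\<close>, divided by the weight of all nodes of that axis.

  The one-dimensional weight sums telescope, since the kernel \<^term>\<open>phi \<sigma>\<close> is a difference of two
  translates of \<open>\<sigma>\<close>. All nodes together weigh at least \<open>phi logistic 0\<close> (\<open>sum_phi_ge\<close>).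
  The nodes beyond a cell end at \<open>m\<close> weigh at most a constant times \<open>logistic u\<close> with
  \<open>u = - n * \<bar>t - m\<bar>\<close>, and since \<open>u \<le> 0\<close> this is at most twice the derivative
  \<open>logistic u * (1 - logistic u)\<close> (\<open>sum_phi_right_tail\<close>, \<open>sum_phi_left_tail\<close>). Summing
  over the cell ends \<open>m = 0, ..., N\<close> gives a majorant that is smooth in \<open>t\<close>, and each summand has a
  primitive with values between \<open>0\<close> and \<open>1 / n\<close> up to a constant factor; hence the error has \<open>L\<^sup>1\<close> norm at most a constant over \<open>n\<close>
  (\<open>nn_op_error_bounds\<close>, \<open>integral_edge_densities_le\<close>).

  Because the error is also at most 255 everywhere, the \<open>p\<close>-th power of error/255 is at most
  error/255, so the \<open>L\<^sup>p\<close> norm is at most a constant times \<open>(1 / n) powr (1 / p)\<close>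
  (\<open>nn_op_error_Lp\<close>). This is one of the two summands of the claimed rate; the other one,
  with \<open>ln n\<close>, is nonnegative and eventually the larger of the two.\<close>

section \<open>The logistic function\<close>

lemma logistic_bounds: "0 < logistic x" "logistic x < 1"
  by (auto simp: logistic_def add_pos_pos divide_simps)

lemma logistic_minus: "logistic (- x) = 1 - logistic x"
  unfolding logistic_def by (simp add: exp_minus field_simps add_pos_pos add_nonneg_eq_0_iff)

lemma logistic_mono: "x \<le> y \<Longrightarrow> logistic x \<le> logistic y"
  unfolding logistic_def by (intro divide_left_mono) (auto simp: add_pos_pos)

lemma logistic_strict_mono: "x < y \<Longrightarrow> logistic x < logistic y"
  unfolding logistic_def by (intro divide_strict_left_mono) (auto simp: add_pos_pos)

lemma logistic_has_derivative:
  "(logistic has_real_derivative logistic x * (1 - logistic x)) (at x)"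
proof -
  have pos: "1 + exp (- x) > 0" by (simp add: add_pos_pos)
  have "((\<lambda>x. 1 / (1 + exp (- x))) has_real_derivative
          exp (- x) / ((1 + exp (- x)) * (1 + exp (- x)))) (at x)"
    using pos by (auto intro!: derivative_eq_intros)
  also have "exp (- x) / ((1 + exp (- x)) * (1 + exp (- x))) = logistic x * (1 - logistic x)"
    using pos by (simp add: logistic_def field_simps)
  finally show ?thesis unfolding logistic_def[abs_def] .
qed

lemma continuous_on_logistic [continuous_intros]:
  "continuous_on S g \<Longrightarrow> continuous_on S (\<lambda>x. logistic (g x))"
  unfolding logistic_def
  by (intro continuous_intros) (auto simp: add_nonneg_eq_0_iff)

text \<open>This is the derivative of the logistic function.\<close>

definition logistic_density :: "real \<Rightarrow> real" where
  "logistic_density u = logistic u * (1 - logistic u)"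

lemma logistic_density_nonneg: "0 \<le> logistic_density u"
  unfolding logistic_density_def using logistic_bounds[of u] by simp

text \<open>For \<open>u \<le> 0\<close> the second factor of the density is at least \<open>1/2\<close>. The density is the derivative
  of the logistic function, so this replaces a tail by a function with a bounded primitive.\<close>

lemma logistic_le_density:
  assumes "u \<le> 0" shows "logistic u \<le> 2 * logistic_density u"
proof -
  have "logistic u \<le> 1/2"
    using logistic_mono[OF assms] by (simp add: logistic_def)
  then have "logistic u * 1 \<le> logistic u * (2 * (1 - logistic u))"
    using logistic_bounds[of u] by (intro mult_left_mono) auto
  then show ?thesis by (simp add: logistic_density_def algebra_simps)
qed

lemma logistic_density_minus: "logistic_density (- u) = logistic_density u"
  by (simp add: logistic_density_def logistic_minus)

text \<open>The telescoped tails below end one step to the right of the cell boundary; this moves them back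
  to the boundary at the cost of a factor \<open>e\<close>.\<close>

lemma logistic_shift_le: "logistic (u + 1) \<le> exp 1 * logistic u"
proof -
  define v where "v = exp (- (u + 1))"
  have "exp (- u) = exp 1 * v" by (simp add: v_def flip: exp_add)
  then have "logistic u = 1 / (1 + exp 1 * v)" by (simp add: logistic_def)
  moreover have "logistic (u + 1) = 1 / (1 + v)" by (simp add: logistic_def v_def)
  moreover have "1 / (1 + v) \<le> exp 1 * (1 / (1 + exp 1 * v))"
  proof -
    have "0 < v" "1 \<le> exp (1::real)" by (simp_all add: v_def)
    moreover from this have "0 < 1 + v" "0 < 1 + exp 1 * v" by (simp_all add: add_pos_pos)
    ultimately show ?thesis by (simp add: field_simps)
  qed
  ultimately show ?thesis by simp
qed

text \<open>The primitive \<open>logistic (n * (t - m)) / n\<close> takes values between \<open>0\<close> and \<open>1 / n\<close>, so the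
  bound is uniform in the interval and in \<open>m\<close>.\<close>

lemma integral_logistic_density_le:
  assumes "0 < n" "a \<le> b"
  shows "integral {a..b} (\<lambda>t. logistic_density (n * (t - m))) \<le> 1 / n"
proof -
  have "((\<lambda>t. logistic_density (n * (t - m))) has_integral
          (logistic (n * (b - m)) / n - logistic (n * (a - m)) / n)) {a..b}"
  proof (rule fundamental_theorem_of_calculus[OF \<open>a \<le> b\<close>])
    fix t
    have "((\<lambda>t. logistic (n * (t - m))) has_real_derivative
            logistic_density (n * (t - m)) * n) (at t)"
      unfolding logistic_density_def
      by (rule DERIV_chain2[OF logistic_has_derivative]) (auto intro!: derivative_eq_intros)
    from DERIV_cdivide[OF this, of n]
    show "((\<lambda>t. logistic (n * (t - m)) / n) has_vector_derivative logistic_density (n * (t - m)))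
            (at t within {a..b})"
      using \<open>0 < n\<close>
      by (simp add: has_real_derivative_iff_has_vector_derivative has_vector_derivative_at_within)
  qed
  then have "integral {a..b} (\<lambda>t. logistic_density (n * (t - m))) =
      (logistic (n * (b - m)) - logistic (n * (a - m))) / n"
    by (simp add: integral_unique diff_divide_distrib)
  also have "\<dots> \<le> 1 / n"
    using logistic_bounds[of "n * (b - m)"] logistic_bounds[of "n * (a - m)"] \<open>0 < n\<close>
    by (intro divide_right_mono) auto
  finally show ?thesis .
qed

section \<open>Sums of the kernel over the nodes\<close>

lemma phi_logistic_pos: "0 < phi logistic u"
  unfolding phi_def using logistic_strict_mono[of "u - 1" "u + 1"] by simp

text \<open>The kernel is half a difference over a step of length 2, so two interleaved telescoping sums
  remain, with two boundary terms at each end. The hypothesis \<open>a \<le> b + 1\<close> includes the empty sum.\<close>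

lemma sum_phi_telescope:
  fixes a b :: int
  assumes "a \<le> b + 1"
  shows "(\<Sum>k\<in>{a..b}. phi \<sigma> (u - of_int k)) =
    (\<sigma> (u - of_int a + 1) + \<sigma> (u - of_int a) - \<sigma> (u - of_int b) - \<sigma> (u - of_int b - 1)) / 2"
proof -
  \<comment> \<open>The induction is on the half-open range, which starts from the empty sum at \<open>c = a\<close>.\<close>
  have "(\<Sum>k\<in>{a..c - 1}. phi \<sigma> (u - of_int k)) =
    (\<sigma> (u - of_int a + 1) + \<sigma> (u - of_int a) - \<sigma> (u - of_int c + 1) - \<sigma> (u - of_int c)) / 2"
    if "a \<le> c" for c
    using that
  proof (induction c rule: int_ge_induct)
    case base
    then show ?case by simp
  next
    case (step c)
    have "{a..c + 1 - 1} = insert c {a..c - 1}" using step.hyps by auto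
    then show ?case
      using step.IH by (simp add: phi_def field_simps)
  qed
  from this[OF assms] show ?thesis by (simp add: algebra_simps)
qed

text \<open>Near the ends of the range about half of the total mass of the kernel lies outside, but the four
  boundary terms of the telescoped sum are monotone in \<open>u\<close>, so replacing \<open>u\<close> by \<open>0\<close> in the first
  two and by \<open>K\<close> in the last two leaves \<open>(logistic 1 - logistic (- 1)) / 2 = phi logistic 0\<close>.\<close>

lemma sum_phi_ge:
  fixes K :: int
  assumes "0 \<le> u" "u \<le> of_int K"
  shows "phi logistic 0 \<le> (\<Sum>k\<in>{0..K}. phi logistic (u - of_int k))"
proof -
  have "0 \<le> K" using assms by linarith
  then have "(\<Sum>k\<in>{0..K}. phi logistic (u - of_int k)) =
      (logistic (u + 1) + logistic u - logistic (u - of_int K) - logistic (u - of_int K - 1)) / 2"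
    using sum_phi_telescope[of 0 K logistic u] by simp
  moreover have "logistic 1 \<le> logistic (u + 1)" "logistic 0 \<le> logistic u"
    "logistic (u - of_int K) \<le> logistic 0" "logistic (u - of_int K - 1) \<le> logistic (- 1)"
    using assms by (auto intro!: logistic_mono)
  ultimately show ?thesis by (simp add: phi_def)
qed

text \<open>After telescoping, the two terms at the end \<open>b\<close> are dropped and the larger one of the two terms
  at \<open>a\<close> is kept.\<close>

lemma sum_phi_right_tail:
  fixes a b :: int
  assumes "a \<le> b + 1" "u \<le> of_int a"
  shows "(\<Sum>k\<in>{a..b}. phi logistic (u - of_int k)) \<le> 2 * exp 1 * logistic_density (u - of_int a)"
proof -
  have "(\<Sum>k\<in>{a..b}. phi logistic (u - of_int k)) \<le> logistic (u - of_int a + 1)"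
    using sum_phi_telescope[OF assms(1), of logistic u] logistic_bounds(1)[of "u - of_int b"]
      logistic_bounds(1)[of "u - of_int b - 1"] logistic_mono[of "u - of_int a" "u - of_int a + 1"]
    by simp
  also have "\<dots> \<le> exp 1 * logistic (u - of_int a)" by (rule logistic_shift_le)
  also have "\<dots> \<le> exp 1 * (2 * logistic_density (u - of_int a))"
    using assms(2) by (intro mult_left_mono logistic_le_density) auto
  finally show ?thesis by simp
qed

lemma phi_logistic_minus: "phi logistic (- u) = phi logistic u"
proof -
  have "- u + 1 = - (u - 1)" "- u - 1 = - (u + 1)" by simp_all
  then show ?thesis unfolding phi_def by (simp only: logistic_minus) simp
qed

text \<open>The mirror image of \<open>sum_phi_right_tail\<close>, since the kernel and the density are even.\<close>

lemma sum_phi_left_tail: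
  fixes a b :: int
  assumes "a \<le> b + 1" "of_int b \<le> u"
  shows "(\<Sum>k\<in>{a..b}. phi logistic (u - of_int k)) \<le> 2 * exp 1 * logistic_density (u - of_int b)"
proof -
  have "(\<Sum>k\<in>{a..b}. phi logistic (u - of_int k)) =
      (\<Sum>k\<in>{-b..-a}. phi logistic (- u - of_int k))"
    by (rule sum.reindex_bij_witness[of _ uminus uminus])
       (use phi_logistic_minus in \<open>auto simp: algebra_simps\<close>,
        metis minus_diff_eq phi_logistic_minus)
  also have "\<dots> \<le> 2 * exp 1 * logistic_density (- u - of_int (- b))"
    using assms by (intro sum_phi_right_tail) auto
  also have "logistic_density (- u - of_int (- b)) = logistic_density (u - of_int b)"
    using logistic_density_minus[of "u - of_int b"] by simp
  finally show ?thesis .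
qed


section \<open>Pixels\<close>

lemma unit_cell_cover:
  assumes "t \<in> {0..real N}" "0 < N"
  obtains i where "i \<in> {1..N}" "t \<in> unit_cell N i"
proof (cases "t = real N")
  case True
  with assms have "N \<in> {1..N}" "t \<in> unit_cell N N" by (auto simp: unit_cell_def)
  then show thesis by (rule that)
next
  case False
  define i where "i = nat \<lfloor>t\<rfloor> + 1"
  have "real i = of_int \<lfloor>t\<rfloor> + 1" using assms(1) by (simp add: i_def)
  then have t: "real i - 1 \<le> t" "t < real i" using floor_correct[of t] by linarith+
  then have "i \<in> {1..N}" "t \<in> unit_cell N i"
    using assms(1) False by (auto simp: i_def unit_cell_def)
  then show thesis by (rule that)
qed

lemma unit_cell_unique:
  assumes "i \<in> {1..N}" "j \<in> {1..N}" "t \<in> unit_cell N i" "t \<in> unit_cell N j"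
  shows "i = j"
proof -
  have aux: False
    if "i' < j'" "j' \<le> N" "t \<in> unit_cell N i'" "t \<in> unit_cell N j'" for i' j' :: nat
    using that by (auto simp: unit_cell_def split: if_splits)
  show ?thesis using assms aux[of i j] aux[of j i] by (cases i j rule: linorder_cases) auto
qed

text \<open>The pixels are disjoint, so at most one summand of the representation is nonzero at a point.\<close>

lemma digital_image_eq_on_pixels:
  assumes "digital_image N M f"
  shows "\<exists>F :: nat \<Rightarrow> nat \<Rightarrow> real. \<forall>i\<in>{1..N}. \<forall>j\<in>{1..M}. 0 \<le> F i j \<and> F i j \<le> 255 \<and>
    (\<forall>s\<in>unit_cell N i. \<forall>t\<in>unit_cell M j. f (s, t) = F i j)"
proof -
  obtain F :: "nat \<Rightarrow> nat \<Rightarrow> nat" where F: "\<forall>i\<in>{1..N}. \<forall>j\<in>{1..M}. F i j \<in> {0..255}"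
    and f: "\<forall>x\<in>image_domain N M.
           f x = (\<Sum>i = 1..N. \<Sum>j = 1..M.
                    real (F i j) * indicator (unit_cell N i \<times> unit_cell M j) x)"
    using assms unfolding digital_image_def by blast
  show ?thesis
  proof (intro exI[of _ "\<lambda>i j. real (F i j)"] ballI conjI)
    fix i j assume "i \<in> {1..N}" "j \<in> {1..M}"
    with F have "F i j \<le> 255" by auto
    then show "0 \<le> real (F i j)" "real (F i j) \<le> 255" by simp_all
  next
    fix i j s t
    assume ij: "i \<in> {1..N}" "j \<in> {1..M}" and st: "s \<in> unit_cell N i" "t \<in> unit_cell M j"
    have "real i \<le> real N" "1 \<le> real i" "real j \<le> real M" "1 \<le> real j" using ij by auto
    then have "s \<in> {0..real N}" "t \<in> {0..real M}"
      using st unfolding unit_cell_def by (auto split: if_splits)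
    then have "f (s, t) = (\<Sum>i' = 1..N. \<Sum>j' = 1..M.
                    real (F i' j') * indicator (unit_cell N i' \<times> unit_cell M j') (s, t))"
      using f by (auto simp: image_domain_def)
    also have "\<dots> = (\<Sum>i' = 1..N. \<Sum>j' = 1..M. if i' = i then if j' = j then real (F i j) else 0 else 0)"
    proof (intro sum.cong refl)
      fix i' j' assume ij': "i' \<in> {1..N}" "j' \<in> {1..M}"
      have "s \<in> unit_cell N i' \<longleftrightarrow> i' = i"
        using unit_cell_unique[OF ij'(1) ij(1) _ st(1)] st(1) by blast
      moreover have "t \<in> unit_cell M j' \<longleftrightarrow> j' = j"
        using unit_cell_unique[OF ij'(2) ij(2) _ st(2)] st(2) by blast
      ultimately show "real (F i' j') * indicator (unit_cell N i' \<times> unit_cell M j') (s, t) =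
          (if i' = i then if j' = j then real (F i j) else 0 else 0)"
        by (simp add: indicator_def)
    qed
    also have "\<dots> = (\<Sum>i' = 1..N. if i' = i then real (F i j) else 0)"
      using ij by (intro sum.cong refl) auto
    also have "\<dots> = real (F i j)" using ij by auto
    finally show "f (s, t) = real (F i j)" .
  qed
qed

text \<open>Summing over all boundary points of cells of the axis, instead of the two ends of the cell that
  contains \<open>t\<close>, makes the majorant continuous in \<open>t\<close> and independent of the cell.\<close>

definition edge_density :: "nat \<Rightarrow> nat \<Rightarrow> real \<Rightarrow> real" where
  "edge_density N n t = (\<Sum>m\<le>N. logistic_density (real n * (t - real m)))"

text \<open>The nodes outside the cell of \<open>t\<close> form a left tail that ends at or before \<open>n * (i - 1)\<close> and a
  right tail that starts at or after \<open>n * i\<close>. Enlarging them to end exactly at these indices puts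
  the two densities at the ends of the cell, whichever of its ends the cell includes.\<close>

lemma sum_phi_outside_cell_le:
  assumes i: "i \<in> {1..N}" and t: "t \<in> unit_cell N i" and n: "0 < n"
  shows "(\<Sum>k | k \<in> {0..int (n * N)} \<and> of_int k / real n \<notin> unit_cell N i.
            phi logistic (real n * t - of_int k)) \<le> 2 * exp 1 * edge_density N n t"
proof -
  define l r where "l = int (n * (i - 1))" and "r = int (n * i)"
  have ri: "real (i - 1) = real i - 1" using i by (auto simp: of_nat_diff)
  have l: "of_int l = real n * (real i - 1)" and r: "of_int r = real n * real i"
    unfolding l_def r_def of_int_of_nat_eq of_nat_mult[where 'a = real] ri by (rule refl)+
  have ti: "real i - 1 \<le> t" "t \<le> real i"
    using t by (auto simp: unit_cell_def split: if_splits)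
  have "r \<le> int (n * N)" "0 \<le> l" using i by (auto simp: r_def l_def simp del: of_nat_mult)
  have sub: "{k. k \<in> {0..int (n * N)} \<and> of_int k / real n \<notin> unit_cell N i} \<subseteq> {0..l} \<union> {r..int (n * N)}"
  proof
    fix k assume k: "k \<in> {k. k \<in> {0..int (n * N)} \<and> of_int k / real n \<notin> unit_cell N i}"
    then have "of_int k / real n < real i - 1 \<or> real i \<le> of_int k / real n"
      by (auto simp: unit_cell_def split: if_splits)
    then have "real_of_int k \<le> of_int l \<or> of_int r \<le> real_of_int k"
      unfolding l r using n by (auto simp: field_simps)
    then show "k \<in> {0..l} \<union> {r..int (n * N)}" using k by auto
  qed
  let ?w = "\<lambda>k::int. phi logistic (real n * t - of_int k)"
  have w: "0 \<le> ?w k" for k using phi_logistic_pos less_imp_le by blast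
  have "(\<Sum>k | k \<in> {0..int (n * N)} \<and> of_int k / real n \<notin> unit_cell N i. ?w k)
      \<le> sum ?w ({0..l} \<union> {r..int (n * N)})"
    using sub w by (intro sum_mono2) auto
  also have "\<dots> \<le> sum ?w {0..l} + sum ?w {r..int (n * N)}"
    using sum.union_inter[of "{0..l}" "{r..int (n * N)}" ?w]
      sum_nonneg[of "{0..l} \<inter> {r..int (n * N)}" ?w] w by simp
  also have "\<dots> \<le> 2 * exp 1 * logistic_density (real n * t - of_int l)
      + 2 * exp 1 * logistic_density (real n * t - of_int r)"
  proof (intro add_mono sum_phi_left_tail sum_phi_right_tail)
    show "of_int l \<le> real n * t" "real n * t \<le> of_int r"
      unfolding l r using ti by (auto intro!: mult_left_mono)
  qed (use \<open>r \<le> _\<close> \<open>0 \<le> l\<close> in auto)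
  also have "\<dots> = 2 * exp 1 * (\<Sum>m\<in>{i - 1, i}. logistic_density (real n * (t - real m)))"
  proof -
    have "i - 1 \<noteq> i" using i by auto
    then have "(\<Sum>m\<in>{i - 1, i}. logistic_density (real n * (t - real m))) =
        logistic_density (real n * (t - real (i - 1))) + logistic_density (real n * (t - real i))"
      by simp
    then show ?thesis
      unfolding l r ri right_diff_distrib[of "real n"] by (simp only: distrib_left)
  qed
  also have "\<dots> \<le> 2 * exp 1 * edge_density N n t"
    unfolding edge_density_def using i logistic_density_nonneg
    by (intro mult_left_mono sum_mono2) auto
  finally show ?thesis .
qed

lemma sum_node_indices_product:
  "(\<Sum>(k1, k2)\<in>node_indices N M n. g k1 * h k2) =
     (\<Sum>k\<in>{0..int (n * N)}. g k) * (\<Sum>k\<in>{0..int (n * M)}. h k :: real)"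
  unfolding node_indices_def by (simp add: sum_product sum.cartesian_product)

lemma node_in_domain:
  assumes "k \<in> {0..int (n * N)}" "0 < n"
  shows "of_int k / real n \<in> {0..real N}"
proof -
  have "real_of_int k \<le> of_int (int (n * N))" using assms(1) by (subst of_int_le_iff) simp
  then show ?thesis using assms by (auto simp: field_simps)
qed

text \<open>The factor \<open>2 e\<close> comes from the tail estimates, the denominator from the lower bound for the
  total weight.\<close>

definition kernel_constant :: real where
  "kernel_constant = 2 * exp 1 / phi logistic 0"

text \<open>The error is the weighted mean of the differences \<open>f (k / n) - f x\<close>. Bounding each of them by
  255 gives the first claim. For the second, a difference is zero unless at least one coordinate
  of the node leaves the cell of the same coordinate of \<open>x\<close>; a union bound splits these nodes into
  two families, and in each one the sum over the unconstrained coordinate cancels against the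
  denominator.\<close>

lemma nn_op_error_bounds:
  assumes f: "digital_image N M f" and N: "0 < N" and M: "0 < M" and n: "0 < n"
    and x: "x \<in> image_domain N M"
  shows "\<bar>nn_op logistic N M n f x - f x\<bar> \<le> 255"
    and "\<bar>nn_op logistic N M n f x - f x\<bar> \<le>
      255 * (kernel_constant * (edge_density N n (fst x) + edge_density M n (snd x)))"
proof -
  obtain x1 x2 where x12: "x = (x1, x2)" by (cases x)
  then have x1: "x1 \<in> {0..real N}" and x2: "x2 \<in> {0..real M}" using x by (auto simp: image_domain_def)
  obtain F :: "nat \<Rightarrow> nat \<Rightarrow> real" where
    F: "\<And>i j. \<lbrakk>i \<in> {1..N}; j \<in> {1..M}\<rbrakk> \<Longrightarrow> 0 \<le> F i j \<and> F i j \<le> 255" and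
    fF: "\<And>i j s t. \<lbrakk>i \<in> {1..N}; j \<in> {1..M}; s \<in> unit_cell N i; t \<in> unit_cell M j\<rbrakk> \<Longrightarrow> f (s, t) = F i j"
    using digital_image_eq_on_pixels[OF f] by blast
  obtain i where i: "i \<in> {1..N}" "x1 \<in> unit_cell N i" by (rule unit_cell_cover[OF x1 N])
  obtain j where j: "j \<in> {1..M}" "x2 \<in> unit_cell M j" by (rule unit_cell_cover[OF x2 M])
  have f_range: "0 \<le> f (s, t) \<and> f (s, t) \<le> 255" if s: "s \<in> {0..real N}" and t: "t \<in> {0..real M}" for s t
  proof -
    obtain i where i: "i \<in> {1..N}" "s \<in> unit_cell N i" by (rule unit_cell_cover[OF s N])
    obtain j where j: "j \<in> {1..M}" "t \<in> unit_cell M j" by (rule unit_cell_cover[OF t M])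
    show ?thesis using F[OF i(1) j(1)] fF[OF i(1) j(1) i(2) j(2)] by simp
  qed
  define w1 w2 where "w1 k = phi logistic (real n * x1 - of_int k)"
    and "w2 k = phi logistic (real n * x2 - of_int k)" for k :: int
  define S1 S2 where "S1 = sum w1 {0..int (n * N)}" and "S2 = sum w2 {0..int (n * M)}"
  \<comment> \<open>Indicators of the nodes that leave the row or the column of pixels through \<open>x\<close>.\<close>
  define b1 b2 where "b1 k = (of_bool (of_int k / real n \<notin> unit_cell N i) :: real)"
    and "b2 k = (of_bool (of_int k / real n \<notin> unit_cell M j) :: real)" for k :: int
  define g where "g k1 k2 = f (of_int k1 / real n, of_int k2 / real n) - f x" for k1 k2 :: int
  have w: "0 \<le> w1 k" "0 \<le> w2 k" for k
    unfolding w1_def w2_def by (simp_all add: phi_logistic_pos less_imp_le)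
  have phi0: "0 < phi logistic 0" by (rule phi_logistic_pos)
  have S1: "phi logistic 0 \<le> S1" and S2: "phi logistic 0 \<le> S2"
    unfolding S1_def S2_def w1_def w2_def
    by (rule sum_phi_ge; use x1 x2 n in \<open>simp add: mult_left_mono\<close>)+
  have pos: "0 < S1" "0 < S2" using S1 S2 phi0 by linarith+
  have err: "nn_op logistic N M n f x - f x =
      (\<Sum>(k1, k2)\<in>node_indices N M n. g k1 k2 * (w1 k1 * w2 k2)) / (S1 * S2)"
  proof -
    have den: "(\<Sum>(k1, k2)\<in>node_indices N M n. w1 k1 * w2 k2) = S1 * S2"
      unfolding S1_def S2_def by (rule sum_node_indices_product)
    have "nn_op logistic N M n f x =
        (\<Sum>(k1, k2)\<in>node_indices N M n. f (of_int k1 / real n, of_int k2 / real n) * (w1 k1 * w2 k2)) / (S1 * S2)"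
      unfolding den[symmetric] by (simp add: nn_op_def Psi_def w1_def w2_def x12)
    moreover have "f x = (\<Sum>(k1, k2)\<in>node_indices N M n. f x * (w1 k1 * w2 k2)) / (S1 * S2)"
      using pos den by (simp add: sum_distrib_left[symmetric] case_prod_unfold)
    ultimately show ?thesis
      by (simp add: g_def left_diff_distrib case_prod_unfold sum_subtractf diff_divide_distrib)
  qed
  \<comment> \<open>Used twice: with \<open>c = 255\<close> and with the union bound \<open>255 * (b1 + b2)\<close>.\<close>
  have bound: "\<bar>nn_op logistic N M n f x - f x\<bar> \<le>
      (\<Sum>(k1, k2)\<in>node_indices N M n. c k1 k2 * (w1 k1 * w2 k2)) / (S1 * S2)"
    if c: "\<And>k1 k2. \<lbrakk>k1 \<in> {0..int (n * N)}; k2 \<in> {0..int (n * M)}\<rbrakk> \<Longrightarrow> \<bar>g k1 k2\<bar> \<le> c k1 k2" for c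
  proof -
    have "\<bar>\<Sum>(k1, k2)\<in>node_indices N M n. g k1 k2 * (w1 k1 * w2 k2)\<bar> \<le>
        (\<Sum>(k1, k2)\<in>node_indices N M n. c k1 k2 * (w1 k1 * w2 k2))"
    proof (rule order_trans[OF sum_abs sum_mono])
      fix k assume "k \<in> node_indices N M n"
      then obtain k1 k2 where k: "k = (k1, k2)" "k1 \<in> {0..int (n * N)}" "k2 \<in> {0..int (n * M)}"
        by (auto simp: node_indices_def)
      have "0 \<le> w1 k1 * w2 k2" using w by simp
      then show "\<bar>case k of (k1, k2) \<Rightarrow> g k1 k2 * (w1 k1 * w2 k2)\<bar>
          \<le> (case k of (k1, k2) \<Rightarrow> c k1 k2 * (w1 k1 * w2 k2))"
        using mult_right_mono[OF c[OF k(2,3)]]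
        unfolding k(1) prod.case abs_mult[of "g k1 k2"] by (simp only: abs_of_nonneg)
    qed
    then show ?thesis unfolding err using pos by (simp add: abs_mult divide_right_mono)
  qed
  have g255: "\<bar>g k1 k2\<bar> \<le> 255" if "k1 \<in> {0..int (n * N)}" "k2 \<in> {0..int (n * M)}" for k1 k2
    using f_range[OF node_in_domain[OF that(1) n] node_in_domain[OF that(2) n]] f_range[OF x1 x2]
    by (simp add: g_def x12 abs_le_iff)
  show "\<bar>nn_op logistic N M n f x - f x\<bar> \<le> 255"
  proof -
    have "(\<Sum>(k1, k2)\<in>node_indices N M n. 255 * (w1 k1 * w2 k2)) = 255 * (S1 * S2)"
      unfolding S1_def S2_def sum_node_indices_product[symmetric]
      by (simp add: case_prod_unfold sum_distrib_left)
    then show ?thesis using bound[OF g255] pos by simp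
  qed
  have g_cases: "\<bar>g k1 k2\<bar> \<le> 255 * (b1 k1 + b2 k2)"
    if "k1 \<in> {0..int (n * N)}" "k2 \<in> {0..int (n * M)}" for k1 k2
  proof (cases "of_int k1 / real n \<in> unit_cell N i \<and> of_int k2 / real n \<in> unit_cell M j")
    case True
    then have "g k1 k2 = 0" using fF[OF i(1) j(1)] i j by (simp add: g_def x12)
    then show ?thesis by (simp add: b1_def b2_def)
  next
    case False
    then have "1 \<le> b1 k1 + b2 k2" by (auto simp: b1_def b2_def)
    then have "255 * 1 \<le> 255 * (b1 k1 + b2 k2)" by (intro mult_left_mono) auto
    then show ?thesis using g255[OF that] by simp
  qed
  have B1: "(\<Sum>k\<in>{0..int (n * N)}. b1 k * w1 k) \<le> 2 * exp 1 * edge_density N n x1"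
    and B2: "(\<Sum>k\<in>{0..int (n * M)}. b2 k * w2 k) \<le> 2 * exp 1 * edge_density M n x2"
  proof -
    have filter: "(\<Sum>k\<in>A. of_bool (P k) * w k) = sum w {k. k \<in> A \<and> P k}"
      if "finite A" for A P and w :: "int \<Rightarrow> real"
      unfolding sum.inter_filter[OF that] by (intro sum.cong) auto
    show "(\<Sum>k\<in>{0..int (n * N)}. b1 k * w1 k) \<le> 2 * exp 1 * edge_density N n x1"
      unfolding b1_def w1_def filter[OF finite_atLeastAtMost_int]
      by (rule sum_phi_outside_cell_le[OF i n])
    show "(\<Sum>k\<in>{0..int (n * M)}. b2 k * w2 k) \<le> 2 * exp 1 * edge_density M n x2"
      unfolding b2_def w2_def filter[OF finite_atLeastAtMost_int]
      by (rule sum_phi_outside_cell_le[OF j n])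
  qed
  have e: "0 \<le> edge_density N n x1" "0 \<le> edge_density M n x2"
    by (auto simp: edge_density_def logistic_density_nonneg intro!: sum_nonneg)
  have "\<bar>nn_op logistic N M n f x - f x\<bar> \<le>
      (\<Sum>(k1, k2)\<in>node_indices N M n. (255 * (b1 k1 + b2 k2)) * (w1 k1 * w2 k2)) / (S1 * S2)"
    by (rule bound[OF g_cases])
  also have "(\<Sum>(k1, k2)\<in>node_indices N M n. (255 * (b1 k1 + b2 k2)) * (w1 k1 * w2 k2)) =
      255 * ((\<Sum>(k1, k2)\<in>node_indices N M n. (b1 k1 * w1 k1) * w2 k2) +
             (\<Sum>(k1, k2)\<in>node_indices N M n. w1 k1 * (b2 k2 * w2 k2)))"
  proof -
    have "(255 * (b1 k1 + b2 k2)) * (w1 k1 * w2 k2) =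
        255 * ((b1 k1 * w1 k1) * w2 k2) + 255 * (w1 k1 * (b2 k2 * w2 k2))" for k1 k2
      by algebra
    then show ?thesis
      by (simp only: case_prod_unfold sum.distrib distrib_left sum_distrib_left)
  qed
  also have "\<dots> = 255 * ((\<Sum>k\<in>{0..int (n * N)}. b1 k * w1 k) * S2 +
             S1 * (\<Sum>k\<in>{0..int (n * M)}. b2 k * w2 k))"
    using sum_node_indices_product[of "\<lambda>k. b1 k * w1 k" w2 N M n]
      sum_node_indices_product[of w1 "\<lambda>k. b2 k * w2 k" N M n]
    unfolding S1_def S2_def by simp
  also have "\<dots> / (S1 * S2) = 255 * ((\<Sum>k\<in>{0..int (n * N)}. b1 k * w1 k) / S1 +
             (\<Sum>k\<in>{0..int (n * M)}. b2 k * w2 k) / S2)"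
  proof -
    have "255 * (a * S2 + S1 * b) / (S1 * S2) = 255 * (a / S1 + b / S2)" for a b
      using pos by (simp add: field_simps)
    then show ?thesis .
  qed
  also have "\<dots> \<le> 255 * (2 * exp 1 * edge_density N n x1 / phi logistic 0
                        + 2 * exp 1 * edge_density M n x2 / phi logistic 0)"
    by (rule mult_left_mono[OF add_mono[OF frac_le[OF _ B1 phi0 S1] frac_le[OF _ B2 phi0 S2]]])
       (use e in simp_all)
  also have "\<dots> = 255 * (kernel_constant * (edge_density N n (fst x) + edge_density M n (snd x)))"
    unfolding kernel_constant_def x12 fst_conv snd_conv by (simp only: distrib_left times_divide_eq_left)
  finally show "\<bar>nn_op logistic N M n f x - f x\<bar> \<le>
      255 * (kernel_constant * (edge_density N n (fst x) + edge_density M n (snd x)))" .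
qed

section \<open>Integration over the image domain\<close>

lemma image_domain_cbox: "image_domain N M = cbox (0, 0) (real N, real M)"
  by (simp add: image_domain_def cbox_Pair_eq)

text \<open>This gives access to iterated integration of continuous functions, which is stated for the
  Henstock-Kurzweil integral.\<close>

lemma integrable_continuous_image_domain:
  fixes h :: "real \<times> real \<Rightarrow> real"
  assumes "continuous_on (image_domain N M) h"
  shows "integrable (lebesgue_on (image_domain N M)) h"
    and "integral\<^sup>L (lebesgue_on (image_domain N M)) h = integral (image_domain N M) h"
proof -
  have "integrable lborel (\<lambda>x. indicator (image_domain N M) x *\<^sub>R h x)"
    using assms unfolding image_domain_cbox
    by (intro borel_integrable_compact) auto
  then show *: "integrable (lebesgue_on (image_domain N M)) h"
    unfolding image_domain_cbox
    by (subst integrable_restrict_space) (auto simp: integrable_completion)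
  show "integral\<^sup>L (lebesgue_on (image_domain N M)) h = integral (image_domain N M) h"
    using * unfolding image_domain_cbox by (intro lebesgue_integral_eq_integral) auto
qed

lemma continuous_on_edge_density [continuous_intros]:
  "continuous_on S g \<Longrightarrow> continuous_on S (\<lambda>x. edge_density N n (g x))"
  unfolding edge_density_def logistic_density_def by (intro continuous_intros)

lemma integral_edge_density_le:
  assumes "0 < n"
  shows "integral {0..real N} (edge_density N n) \<le> (real N + 1) / real n"
proof -
  have "integral {0..real N} (edge_density N n) =
      (\<Sum>m\<le>N. integral {0..real N} (\<lambda>t. logistic_density (real n * (t - real m))))"
    unfolding edge_density_def[abs_def]
    by (rule integral_sum)
       (auto simp: logistic_density_def intro!: integrable_continuous_real continuous_intros)
  also have "\<dots> \<le> (\<Sum>m\<le>N. 1 / real n)"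
    using assms by (intro sum_mono integral_logistic_density_le) auto
  finally show ?thesis by (simp add: add.commute)
qed

text \<open>Each summand depends on one coordinate only, so integrating over the other one contributes a
  side length as a factor.\<close>

lemma integral_edge_densities_le:
  assumes n: "0 < n"
  shows "integral\<^sup>L (lebesgue_on (image_domain N M))
            (\<lambda>x. edge_density N n (fst x) + edge_density M n (snd x))
         \<le> (real M * (real N + 1) + real N * (real M + 1)) / real n"
proof -
  have cont: "continuous_on S (\<lambda>x::real\<times>real. edge_density N n (fst x) + edge_density M n (snd x))" for S
    by (intro continuous_intros)
  have int: "edge_density K n integrable_on {0..a}" for K and a :: real
    by (intro integrable_continuous_real continuous_intros)
  have "integral\<^sup>L (lebesgue_on (image_domain N M))
            (\<lambda>x. edge_density N n (fst x) + edge_density M n (snd x))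
      = integral {0..real N} (\<lambda>s. integral {0..real M} (\<lambda>t. edge_density N n s + edge_density M n t))"
    using integrable_continuous_image_domain(2)[OF cont] integral_prod_continuous[OF cont]
    by (simp add: image_domain_cbox)
  also have "\<dots> = integral {0..real N} (\<lambda>s. real M * edge_density N n s + integral {0..real M} (edge_density M n))"
    by (intro integral_cong, subst integral_add) (auto intro: int)
  also have "\<dots> = real M * integral {0..real N} (edge_density N n)
      + real N * integral {0..real M} (edge_density M n)"
    by (subst integral_add) (auto intro: int integrable_on_mult_right)
  also have "\<dots> \<le> real M * ((real N + 1) / real n) + real N * ((real M + 1) / real n)"
    by (intro add_mono mult_left_mono integral_edge_density_le n) auto
  also have "\<dots> = (real M * (real N + 1) + real N * (real M + 1)) / real n"
    by (subst add_divide_distrib) simp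
  finally show ?thesis .
qed

lemma digital_image_measurable:
  assumes "digital_image N M f"
  shows "f \<in> borel_measurable (lebesgue_on (image_domain N M))"
proof -
  obtain F :: "nat \<Rightarrow> nat \<Rightarrow> nat" where
    f: "\<forall>x\<in>image_domain N M.
           f x = (\<Sum>i = 1..N. \<Sum>j = 1..M.
                    real (F i j) * indicator (unit_cell N i \<times> unit_cell M j) x)"
    using assms unfolding digital_image_def by blast
  have cell: "unit_cell K i \<in> sets borel" for K i
    by (simp add: unit_cell_def)
  have [measurable]: "unit_cell N i \<times> unit_cell M j \<in> sets borel" for i j
    by (intro borel_Times cell)
  have "(\<lambda>x. \<Sum>i = 1..N. \<Sum>j = 1..M. real (F i j) * indicator (unit_cell N i \<times> unit_cell M j) x)
      \<in> borel_measurable borel" by measurable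
  then have "(\<lambda>x. \<Sum>i = 1..N. \<Sum>j = 1..M. real (F i j) * indicator (unit_cell N i \<times> unit_cell M j) x)
      \<in> borel_measurable (lebesgue_on (image_domain N M))"
    by (intro measurable_restrict_space1 measurable_completion) simp
  then show ?thesis
    by (subst measurable_cong) (use f in auto)
qed

lemma nn_op_measurable:
  "nn_op logistic N M n f \<in> borel_measurable (lebesgue_on S)"
proof -
  have [measurable]: "logistic \<in> borel_measurable borel"
    by (intro borel_measurable_continuous_onI continuous_intros)
  have "nn_op logistic N M n f \<in> borel_measurable borel"
    unfolding nn_op_def[abs_def] case_prod_unfold Psi_def phi_def borel_prod[symmetric] by measurable
  then show ?thesis
    by (intro measurable_restrict_space1 measurable_completion) simp
qed

text \<open>Since \<open>y / B \<le> 1\<close> and \<open>p \<ge> 1\<close>, the \<open>p\<close>-th power of \<open>y / B\<close> is at most \<open>y / B\<close>. This turns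
  the \<open>L\<^sup>1\<close> estimate of a bounded function into an \<open>L\<^sup>p\<close> estimate.\<close>

lemma powr_le_of_bounded:
  assumes "1 \<le> p" "0 \<le> y" "y \<le> B" "y \<le> B * G" "0 < B"
  shows "y powr p \<le> B powr p * (G::real)"
proof -
  have "(y / B) powr p \<le> (y / B) powr 1"
    using assms by (intro powr_mono') auto
  also have "\<dots> \<le> G" using assms by (simp add: field_simps)
  finally have "B powr p * (y / B) powr p \<le> B powr p * G" by (intro mult_left_mono) auto
  then show ?thesis using assms by (simp add: powr_divide)
qed

text \<open>The rate \<open>1 / n\<close> for the integral of the \<open>p\<close>-th power carries no logarithm, because the
  majorant is integrated exactly rather than cut off at a distance from the pixel edges.\<close>

lemma nn_op_error_Lp:
  assumes p: "1 \<le> p" and f: "digital_image N M f" and N: "0 < N" and M: "0 < M" and n: "0 < n"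
  shows "in_Lp p (lebesgue_on (image_domain N M)) (\<lambda>x. nn_op logistic N M n f x - f x)"
    and "Lp_norm p (lebesgue_on (image_domain N M)) (\<lambda>x. nn_op logistic N M n f x - f x) \<le>
      255 * (kernel_constant * (real M * (real N + 1) + real N * (real M + 1))) powr (1 / p)
          * (1 / real n) powr (1 / p)"
proof -
  define \<mu> where "\<mu> = lebesgue_on (image_domain N M)"
  define e where "e x = nn_op logistic N M n f x - f x" for x
  define G where "G x = edge_density N n (fst x) + edge_density M n (snd x)" for x :: "real \<times> real"
  have kc: "0 < kernel_constant" by (simp add: kernel_constant_def phi_logistic_pos)
  have meas [measurable]: "e \<in> borel_measurable \<mu>"
    unfolding e_def[abs_def] \<mu>_def
    by (intro borel_measurable_diff nn_op_measurable digital_image_measurable f)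
  have intG: "integrable \<mu> G"
    unfolding \<mu>_def G_def by (intro integrable_continuous_image_domain continuous_intros)
  have pt: "\<bar>e x\<bar> powr p \<le> 255 powr p * (kernel_constant * G x)" if "x \<in> space \<mu>" for x
    using that nn_op_error_bounds[OF f N M n] p
    by (intro powr_le_of_bounded) (auto simp: \<mu>_def e_def G_def)
  have int: "integrable \<mu> (\<lambda>x. \<bar>e x\<bar> powr p)"
    by (rule Bochner_Integration.integrable_bound[of _ "\<lambda>x. 255 powr p * (kernel_constant * G x)"])
       (use intG pt in \<open>auto intro!: AE_I2 order_trans[OF _ abs_ge_self]\<close>)
  show "in_Lp p (lebesgue_on (image_domain N M)) (\<lambda>x. nn_op logistic N M n f x - f x)"
    using meas int unfolding in_Lp_def \<mu>_def e_def by blast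
  have "(\<integral>x. \<bar>e x\<bar> powr p \<partial>\<mu>) \<le> (\<integral>x. 255 powr p * (kernel_constant * G x) \<partial>\<mu>)"
    using int intG pt by (intro integral_mono) auto
  also have "\<dots> = 255 powr p * (kernel_constant * integral\<^sup>L \<mu> G)" using intG by simp
  also have "\<dots> \<le> 255 powr p * (kernel_constant * ((real M * (real N + 1) + real N * (real M + 1)) / real n))"
    using kc integral_edge_densities_le[OF n, of N M]
    by (intro mult_left_mono) (auto simp: \<mu>_def G_def[abs_def])
  finally have "(\<integral>x. \<bar>e x\<bar> powr p \<partial>\<mu>) powr (1 / p) \<le>
      (255 powr p * ((kernel_constant * (real M * (real N + 1) + real N * (real M + 1))) * (1 / real n))) powr (1 / p)"
    using p by (intro powr_mono2) auto
  also have "\<dots> = 255 * (kernel_constant * (real M * (real N + 1) + real N * (real M + 1))) powr (1 / p)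
          * (1 / real n) powr (1 / p)"
    using p kc by (subst powr_mult | simp add: powr_powr)+
  finally show "Lp_norm p (lebesgue_on (image_domain N M)) (\<lambda>x. nn_op logistic N M n f x - f x) \<le>
      255 * (kernel_constant * (real M * (real N + 1) + real N * (real M + 1))) powr (1 / p)
          * (1 / real n) powr (1 / p)"
    by (simp add: Lp_norm_def e_def \<mu>_def)
qed

lemma rate_bigo:
  assumes "0 < q"
  shows "(\<lambda>n::nat. A * ((ln (real n) / real n) powr q + (1 / real n) powr q))
      \<in> O(\<lambda>n. (ln (real n) / real n) powr q)"
proof -
  have "(1 / real n) powr q \<le> (ln (real n) / real n) powr q" if "3 \<le> n" for n :: nat
  proof -
    \<comment> \<open>From \<open>n = 3\<close> on, \<open>n\<close> exceeds \<open>e\<close> and so \<open>ln n \<ge> 1\<close>.\<close>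
    have "exp 1 \<le> real n" using exp_le that by linarith
    then have "1 \<le> ln (real n)" using that by (subst ln_ge_iff) auto
    then show ?thesis using assms by (intro powr_mono2 divide_right_mono) auto
  qed
  then have "(\<lambda>n::nat. (1 / real n) powr q) \<in> O(\<lambda>n. (ln (real n) / real n) powr q)"
    by (intro bigoI[of _ 1] eventually_at_top_linorderI[of 3]) auto
  then have "(\<lambda>n::nat. (ln (real n) / real n) powr q + (1 / real n) powr q)
      \<in> O(\<lambda>n. (ln (real n) / real n) powr q)"
    by (intro sum_in_bigo) auto
  then show ?thesis by simp
qed

theorem corollary11:
  fixes p :: real and N M :: nat and f :: "real \<times> real \<Rightarrow> real"
  assumes "1 \<le> p" and "0 < N" and "0 < M" and "digital_image N M f"
  shows "\<exists>C>0.
    (\<forall>n::nat. 0 < n \<longrightarrow>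
       in_Lp p (lebesgue_on (image_domain N M)) (\<lambda>x. nn_op logistic N M n f x - f x) \<and>
       Lp_norm p (lebesgue_on (image_domain N M)) (\<lambda>x. nn_op logistic N M n f x - f x)
         \<le> 255 * (2 powr (p - 1) * real M * real N) powr (1 / p) * C *
            ((ln (real n) / real n) powr (1 / p) + (1 / real n) powr (1 / p))) \<and>
    (\<lambda>n::nat. 255 * (2 powr (p - 1) * real M * real N) powr (1 / p) * C *
            ((ln (real n) / real n) powr (1 / p) + (1 / real n) powr (1 / p)))
      \<in> O(\<lambda>n. (ln (real n) / real n) powr (1 / p))"
proof -
  define C where "C = (kernel_constant * (real M * (real N + 1) + real N * (real M + 1))) powr (1 / p)"
  define D where "D = (2 powr (p - 1) * real M * real N) powr (1 / p)"
  have "0 < kernel_constant" by (simp add: kernel_constant_def phi_logistic_pos)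
  moreover have "0 < real M * (real N + 1) + real N * (real M + 1)"
    using assms by (intro add_pos_pos mult_pos_pos) auto
  ultimately have C: "0 < C" by (simp add: C_def)
  \<comment> \<open>The factor in front of \<open>C\<close> is at least 1, so it can only weaken the bound.\<close>
  have "1 * 1 * 1 \<le> 2 powr (p - 1) * real M * real N"
    using assms by (intro mult_mono ge_one_powr_ge_zero) auto
  then have D: "1 \<le> D" unfolding D_def using assms by (intro ge_one_powr_ge_zero) auto
  show ?thesis
  proof (intro exI[of _ C] conjI allI impI)
    fix n :: nat assume n: "0 < n"
    show "in_Lp p (lebesgue_on (image_domain N M)) (\<lambda>x. nn_op logistic N M n f x - f x)"
      using nn_op_error_Lp(1)[OF assms(1,4,2,3) n] .
    have "Lp_norm p (lebesgue_on (image_domain N M)) (\<lambda>x. nn_op logistic N M n f x - f x)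
        \<le> 255 * 1 * C * (0 + (1 / real n) powr (1 / p))"
      using nn_op_error_Lp(2)[OF assms(1,4,2,3) n] by (simp add: C_def)
    also have "\<dots> \<le> 255 * D * C * ((ln (real n) / real n) powr (1 / p) + (1 / real n) powr (1 / p))"
      using C D by (intro mult_mono add_mono) auto
    finally show "Lp_norm p (lebesgue_on (image_domain N M)) (\<lambda>x. nn_op logistic N M n f x - f x)
        \<le> 255 * (2 powr (p - 1) * real M * real N) powr (1 / p) * C *
            ((ln (real n) / real n) powr (1 / p) + (1 / real n) powr (1 / p))"
      by (simp add: D_def)
  next
    show "(\<lambda>n::nat. 255 * (2 powr (p - 1) * real M * real N) powr (1 / p) * C *
            ((ln (real n) / real n) powr (1 / p) + (1 / real n) powr (1 / p)))
      \<in> O(\<lambda>n. (ln (real n) / real n) powr (1 / p))"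
      using assms(1) by (intro rate_bigo) simp
  qed (rule C)
qed

end
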